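(* Let $(L,[\cdot ,\cdot ],\alpha ,\beta )$ be a left (respectively right) BiHom-Leibniz algebra over a field $\Bbbk$, $\lambda \in \Bbbk $ a fixed scalar and $R:L\rightarrow L$ a Rota-Baxter operator of weight $\lambda $ for $(L,[\cdot,\cdot])$ such that $R\circ \alpha =\alpha \circ R$ and $R\circ \beta =\beta \circ R$. Define a new multiplication on $L$ by $$\{x,y\}=[R(x),y]+[x,R(y)]+\lambda [x,y],\quad \forall\, x,y\in L.$$ Then $(L,\{\cdot , \cdot \} ,\alpha ,\beta )$ is a left (respectively right) BiHom-Leibniz algebra.
   Context: All linear spaces and (bi)linear maps are over a base field $\Bbbk$. A left (respectively right) BiHom-Leibniz algebra is a 4-tuple $(L, [\cdot ,\cdot ], \alpha , \beta )$, where $L$ is a linear space, $[\cdot , \cdot ]:L\times L\rightarrow L$ is a bilinear map and $\alpha , \beta :L\rightarrow L$ are linear maps satisfying $\alpha \circ \beta =\beta \circ \alpha $, $\alpha ([x, y])=[\alpha (x), \alpha (y)]$, $\beta ([x, y])=[\beta (x), \beta (y)]$ and $$[\alpha \beta (x), [y, z]]=[[\beta (x), y], \beta (z)]+[\beta (y), [\alpha (x), z]],$$ respectively $$[[x, y], \alpha \beta (z)]=[[x, \beta (z)], \alpha (y)]+[\alpha (x), [y, \alpha (z)]],$$ for all $x, y, z\in L$ (here $\alpha\beta=\alpha\circ\beta$). A Rota-Baxter operator of weight $\lambda$ for $(L,[\cdot,\cdot])$ is a linear map $R:L\to L$ with $[R(x),R(y)]=R([R(x),y]+[x,R(y)]+\lambda[x,y])$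 for all $x,y\in L$. *)

theory Defs
  imports Complex_Main
begin

(* The base field is the type 'k and the linear space L is the whole type 'v, with
   scalar multiplication scale; no topology, dimension or characteristic is assumed. *)

definition bilinear_map :: "('k::field \<Rightarrow> 'v::ab_group_add \<Rightarrow> 'v) \<Rightarrow> ('v \<Rightarrow> 'v \<Rightarrow> 'v) \<Rightarrow> bool"
  where "bilinear_map scale B \<longleftrightarrow>
    (\<forall>x. Vector_Spaces.linear scale scale (\<lambda>y. B x y)) \<and>
    (\<forall>y. Vector_Spaces.linear scale scale (\<lambda>x. B x y))"

locale bihom_algebra = vector_space scale
  for scale :: "'k::field \<Rightarrow> 'v::ab_group_add \<Rightarrow> 'v" +
  fixes br :: "'v \<Rightarrow> 'v \<Rightarrow> 'v"
    and \<alpha> \<beta> :: "'v \<Rightarrow> 'v"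
  assumes bilinear_br: "bilinear_map scale br"
    and linear_\<alpha>: "Vector_Spaces.linear scale scale \<alpha>"
    and linear_\<beta>: "Vector_Spaces.linear scale scale \<beta>"
    and \<alpha>_\<beta>_commute: "\<alpha> \<circ> \<beta> = \<beta> \<circ> \<alpha>"
    and \<alpha>_br: "\<alpha> (br x y) = br (\<alpha> x) (\<alpha> y)"
    and \<beta>_br: "\<beta> (br x y) = br (\<beta> x) (\<beta> y)"

locale left_bihom_leibniz_algebra = bihom_algebra +
  assumes left_leibniz:
    "br (\<alpha> (\<beta> x)) (br y z) = br (br (\<beta> x) y) (\<beta> z) + br (\<beta> y) (br (\<alpha> x) z)"

locale right_bihom_leibniz_algebra = bihom_algebra +
  assumes right_leibniz:
    "br (br x y) (\<alpha> (\<beta> z)) = br (br x (\<beta> z)) (\<alpha> y) + br (\<alpha> x) (br y (\<alpha> z))"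

definition rota_baxter_mult ::
    "('k::field \<Rightarrow> 'v::ab_group_add \<Rightarrow> 'v) \<Rightarrow> ('v \<Rightarrow> 'v \<Rightarrow> 'v) \<Rightarrow> 'k \<Rightarrow> ('v \<Rightarrow> 'v) \<Rightarrow> 'v \<Rightarrow> 'v \<Rightarrow> 'v"
  where "rota_baxter_mult scale br w R x y = br (R x) y + br x (R y) + scale w (br x y)"

definition rota_baxter_operator ::
    "('k::field \<Rightarrow> 'v::ab_group_add \<Rightarrow> 'v) \<Rightarrow> ('v \<Rightarrow> 'v \<Rightarrow> 'v) \<Rightarrow> 'k \<Rightarrow> ('v \<Rightarrow> 'v) \<Rightarrow> bool"
  where "rota_baxter_operator scale br w R \<longleftrightarrow>
    Vector_Spaces.linear scale scale R \<and>
    (\<forall>x y. br (R x) (R y) = R (br (R x) y + br x (R y) + scale w (br x y)))"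

end

theory Submission
  imports Defs
begin

text \<open>
  Write \<open>{x, y}\<close> for the new product.  The Rota-Baxter identity says precisely that
  \<open>R {x, y} = [R x, R y]\<close>.  Hence when \<open>{x, {y, z}}\<close> is expanded, the one term in which \<open>R\<close> is
  applied to a product becomes \<open>[x, [R y, R z]]\<close>, and every remaining occurrence of \<open>R\<close> sits
  directly on \<open>x\<close>, \<open>y\<close> or \<open>z\<close>.  The outcome is the sum of \<open>[x, [y, z]]\<close> over all ways to apply
  \<open>R\<close> to some, but not all, of the three arguments, a choice of \<open>k\<close> arguments having
  the weight \<open>w ^ (2 - k)\<close>.  The product \<open>{{x, y}, z}\<close> expands in the same way from \<open>[[x, y], z]\<close>.

  This sum, \<open>rota_baxter_triple\<close> below, makes sense for any ternary operation, depends additively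
  on that operation, treats its three arguments symmetrically, and is compatible with
  \<open>\<alpha>\<close> and \<open>\<beta>\<close> because \<open>R\<close> commutes with them.  Every term in the left or right BiHom-Leibniz
  identity of \<open>{x, y}\<close> is therefore the \<open>rota_baxter_triple\<close> of the corresponding term for
  \<open>[x, y]\<close>, and the identity for the new product is the \<open>rota_baxter_triple\<close> of the old one.
\<close>

lemma bilinear_map_iff:
  "bilinear_map scale B \<longleftrightarrow> vector_space scale \<and>
    (\<forall>x y z. B x (y + z) = B x y + B x z) \<and> (\<forall>c x y. B x (scale c y) = scale c (B x y)) \<and>
    (\<forall>x y z. B (x + y) z = B x z + B y z) \<and> (\<forall>c x y. B (scale c x) y = scale c (B x y))"
  unfolding bilinear_map_def Vector_Spaces.linear_iff by blast

text \<open>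
  The operation is a parameter, so that the Leibniz identity of the original bracket can be
  substituted for it as an equation between ternary functions.
\<close>

definition rota_baxter_triple ::
    "('k::field \<Rightarrow> 'v::ab_group_add \<Rightarrow> 'v) \<Rightarrow> 'k \<Rightarrow> ('v \<Rightarrow> 'v) \<Rightarrow> ('v \<Rightarrow> 'v \<Rightarrow> 'v \<Rightarrow> 'v)
      \<Rightarrow> 'v \<Rightarrow> 'v \<Rightarrow> 'v \<Rightarrow> 'v"
  where "rota_baxter_triple scale w R f x y z =
    f (R x) (R y) z + f (R x) y (R z) + f x (R y) (R z)
    + scale w (f (R x) y z + f x (R y) z + f x y (R z)) + scale (w * w) (f x y z)"

lemma (in vector_space) rota_baxter_triple_add:
  "rota_baxter_triple scale w R (\<lambda>x y z. f x y z + g x y z) x y z =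
    rota_baxter_triple scale w R f x y z + rota_baxter_triple scale w R g x y z"
  by (simp add: rota_baxter_triple_def scale_right_distrib)

lemma rota_baxter_operator_mult:
  assumes "rota_baxter_operator scale br w R"
  shows "R (rota_baxter_mult scale br w R x y) = br (R x) (R y)"
  using assms by (simp add: rota_baxter_operator_def rota_baxter_mult_def)

text \<open>
  Only the outer product is unfolded at first: this leaves \<open>R\<close> applied to the inner
  product as a whole, where the Rota-Baxter identity absorbs it.  The rest is bilinearity.
\<close>

lemma rota_baxter_mult_nested_right:
  assumes "bilinear_map scale br" and R: "rota_baxter_operator scale br w R"
  shows "rota_baxter_mult scale br w R x (rota_baxter_mult scale br w R y z) =
    rota_baxter_triple scale w R (\<lambda>x y z. br x (br y z)) x y z"
proof -
  interpret vector_space scale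
    using assms(1) by (simp add: bilinear_map_iff)
  have "rota_baxter_mult scale br w R x (rota_baxter_mult scale br w R y z) =
      br (R x) (rota_baxter_mult scale br w R y z) + br x (br (R y) (R z))
      + scale w (br x (rota_baxter_mult scale br w R y z))"
    unfolding rota_baxter_mult_def[of _ _ _ _ x] rota_baxter_operator_mult[OF R] ..
  also have "\<dots> = rota_baxter_triple scale w R (\<lambda>x y z. br x (br y z)) x y z"
    using assms(1)
    by (simp add: bilinear_map_iff rota_baxter_mult_def rota_baxter_triple_def
        scale_right_distrib ac_simps)
  finally show ?thesis .
qed

lemma rota_baxter_mult_nested_left:
  assumes "bilinear_map scale br" and R: "rota_baxter_operator scale br w R"
  shows "rota_baxter_mult scale br w R (rota_baxter_mult scale br w R x y) z =
    rota_baxter_triple scale w R (\<lambda>x y z. br (br x y) z) x y z"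
proof -
  interpret vector_space scale
    using assms(1) by (simp add: bilinear_map_iff)
  have "rota_baxter_mult scale br w R (rota_baxter_mult scale br w R x y) z =
      br (br (R x) (R y)) z + br (rota_baxter_mult scale br w R x y) (R z)
      + scale w (br (rota_baxter_mult scale br w R x y) z)"
    unfolding rota_baxter_mult_def[of _ _ _ _ _ z] rota_baxter_operator_mult[OF R] ..
  also have "\<dots> = rota_baxter_triple scale w R (\<lambda>x y z. br (br x y) z) x y z"
    using assms(1)
    by (simp add: bilinear_map_iff rota_baxter_mult_def rota_baxter_triple_def
        scale_right_distrib ac_simps)
  finally show ?thesis .
qed

lemma bilinear_map_rota_baxter_mult:
  assumes "bilinear_map scale br" and "Vector_Spaces.linear scale scale R"
  shows "bilinear_map scale (rota_baxter_mult scale br w R)"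
proof -
  interpret vector_space scale
    using assms(1) by (simp add: bilinear_map_iff)
  show ?thesis
    using assms
    by (simp add: bilinear_map_iff Vector_Spaces.linear_iff rota_baxter_mult_def
        scale_right_distrib mult.commute ac_simps)
qed

lemma rota_baxter_mult_hom:
  assumes f: "Vector_Spaces.linear scale scale f" "\<And>x y. f (br x y) = br (f x) (f y)"
    and "\<And>x. R (f x) = f (R x)"
  shows "f (rota_baxter_mult scale br w R x y) = rota_baxter_mult scale br w R (f x) (f y)"
  using assms by (simp add: rota_baxter_mult_def Vector_Spaces.linear_iff)

lemma bihom_algebra_rota_baxter_mult:
  assumes "bihom_algebra scale br \<alpha> \<beta>" and "Vector_Spaces.linear scale scale R"
    and "\<And>x. R (\<alpha> x) = \<alpha> (R x)" and "\<And>x. R (\<beta> x) = \<beta> (R x)"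
  shows "bihom_algebra scale (rota_baxter_mult scale br w R) \<alpha> \<beta>"
proof -
  interpret bihom_algebra scale br \<alpha> \<beta> by fact
  show ?thesis
    by (intro bihom_algebra.intro bihom_algebra_axioms.intro vector_space_axioms
        bilinear_map_rota_baxter_mult rota_baxter_mult_hom
        bilinear_br linear_\<alpha> linear_\<beta> \<alpha>_\<beta>_commute \<alpha>_br \<beta>_br assms)
qed

theorem proposition4p15:
  fixes scale :: "'k::field \<Rightarrow> 'v::ab_group_add \<Rightarrow> 'v"
    and br :: "'v \<Rightarrow> 'v \<Rightarrow> 'v"
    and \<alpha> \<beta> R :: "'v \<Rightarrow> 'v"
    and w :: 'k
  assumes "rota_baxter_operator scale br w R"
    and "R \<circ> \<alpha> = \<alpha> \<circ> R"
    and "R \<circ> \<beta> = \<beta> \<circ> R"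
  shows "(left_bihom_leibniz_algebra scale br \<alpha> \<beta> \<longrightarrow>
            left_bihom_leibniz_algebra scale (rota_baxter_mult scale br w R) \<alpha> \<beta>) \<and>
         (right_bihom_leibniz_algebra scale br \<alpha> \<beta> \<longrightarrow>
            right_bihom_leibniz_algebra scale (rota_baxter_mult scale br w R) \<alpha> \<beta>)"
proof (intro conjI impI)
  let ?m = "rota_baxter_mult scale br w R" and ?T = "rota_baxter_triple scale w R"
  note R = assms(1)
  have linear_R: "Vector_Spaces.linear scale scale R"
    using R by (simp add: rota_baxter_operator_def)
  have R\<alpha>: "R (\<alpha> x) = \<alpha> (R x)" and R\<beta>: "R (\<beta> x) = \<beta> (R x)" for x
    using assms(2,3) by (simp_all add: fun_eq_iff)
  {
    assume "left_bihom_leibniz_algebra scale br \<alpha> \<beta>"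
    then interpret left_bihom_leibniz_algebra scale br \<alpha> \<beta> .
    note nested = rota_baxter_mult_nested_right[OF bilinear_br R]
      rota_baxter_mult_nested_left[OF bilinear_br R]
    interpret new: bihom_algebra scale ?m \<alpha> \<beta>
      by (rule bihom_algebra_rota_baxter_mult[OF bihom_algebra_axioms linear_R R\<alpha> R\<beta>])
    show "left_bihom_leibniz_algebra scale ?m \<alpha> \<beta>"
    proof
      fix x y z
      have "?m (\<alpha> (\<beta> x)) (?m y z) = ?T (\<lambda>x y z. br (\<alpha> (\<beta> x)) (br y z)) x y z"
        by (simp add: nested rota_baxter_triple_def R\<alpha> R\<beta>)
      also have "\<dots> = ?T (\<lambda>x y z. br (br (\<beta> x) y) (\<beta> z)) x y z
          + ?T (\<lambda>x y z. br (\<beta> y) (br (\<alpha> x) z)) x y z"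
        by (simp only: left_leibniz rota_baxter_triple_add)
      also have "?T (\<lambda>x y z. br (br (\<beta> x) y) (\<beta> z)) x y z = ?m (?m (\<beta> x) y) (\<beta> z)"
        by (simp add: nested rota_baxter_triple_def R\<beta>)
      \<comment> \<open>Here \<open>x\<close> and \<open>y\<close> trade places; the sum is symmetric in its three arguments.\<close>
      also have "?T (\<lambda>x y z. br (\<beta> y) (br (\<alpha> x) z)) x y z = ?m (\<beta> y) (?m (\<alpha> x) z)"
        by (simp add: nested rota_baxter_triple_def R\<alpha> R\<beta> ac_simps)
      finally show "?m (\<alpha> (\<beta> x)) (?m y z) = ?m (?m (\<beta> x) y) (\<beta> z) + ?m (\<beta> y) (?m (\<alpha> x) z)" .
    qed
  next
    assume "right_bihom_leibniz_algebra scale br \<alpha> \<beta>"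
    then interpret right_bihom_leibniz_algebra scale br \<alpha> \<beta> .
    note nested = rota_baxter_mult_nested_right[OF bilinear_br R]
      rota_baxter_mult_nested_left[OF bilinear_br R]
    interpret new: bihom_algebra scale ?m \<alpha> \<beta>
      by (rule bihom_algebra_rota_baxter_mult[OF bihom_algebra_axioms linear_R R\<alpha> R\<beta>])
    show "right_bihom_leibniz_algebra scale ?m \<alpha> \<beta>"
    proof
      fix x y z
      have "?m (?m x y) (\<alpha> (\<beta> z)) = ?T (\<lambda>x y z. br (br x y) (\<alpha> (\<beta> z))) x y z"
        by (simp add: nested rota_baxter_triple_def R\<alpha> R\<beta>)
      also have "\<dots> = ?T (\<lambda>x y z. br (br x (\<beta> z)) (\<alpha> y)) x y z
          + ?T (\<lambda>x y z. br (\<alpha> x) (br y (\<alpha> z))) x y z"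
        by (simp only: right_leibniz rota_baxter_triple_add)
      \<comment> \<open>Here \<open>y\<close> and \<open>z\<close> trade places.\<close>
      also have "?T (\<lambda>x y z. br (br x (\<beta> z)) (\<alpha> y)) x y z = ?m (?m x (\<beta> z)) (\<alpha> y)"
        by (simp add: nested rota_baxter_triple_def R\<alpha> R\<beta> ac_simps)
      also have "?T (\<lambda>x y z. br (\<alpha> x) (br y (\<alpha> z))) x y z = ?m (\<alpha> x) (?m y (\<alpha> z))"
        by (simp add: nested rota_baxter_triple_def R\<alpha>)
      finally show "?m (?m x y) (\<alpha> (\<beta> z)) = ?m (?m x (\<beta> z)) (\<alpha> y) + ?m (\<alpha> x) (?m y (\<alpha> z))" .
    qed
  }
qed

end
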